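(* Let $k\ge3$ and let $\mathscr{T}\in\mathbb{R}^{n_1\times l\times n_3\times\cdots\times n_k}$ and $\mathscr{S}\in\mathbb{R}^{l\times n_2\times n_3\times\cdots\times n_k}$ be tensors in the HTD format with respect to the same dimension tree $\mathcal{T}$ on $D=\{1,2,\dots,k\}$ with $\{1,2\}\in\mathcal{T}$. Let $\mathbf{U}_t$ and $\mathscr{G}_\tau$ (hierarchical ranks $r_\tau$) and $\mathbf{V}_t$ and $\mathscr{H}_\tau$ (hierarchical ranks $s_\tau$) denote the leaf factor matrices and transfer tensors of $\mathscr{T}$ and $\mathscr{S}$, respectively. Write $\phi(a,b)=a+(b-1)p$, where $a=1,2,\dots,p$ ($p$ is the range of the first index). Let $\mathbf{W}_1=\mathbf{U}_1$, $\mathbf{W}_2=\mathbf{V}_2$, and for $t=3,4,\dots,k$ define $\widetilde{\mathbf{U}}_t=\mathbf{F}_{n_t}\mathbf{U}_t$, $\widetilde{\mathbf{V}}_t=\mathbf{F}_{n_t}\mathbf{V}_t$, $$\widetilde{\mathbf{W}}_t(j_t,\phi(\alpha_t,\beta_t))=\widetilde{\mathbf{U}}_t(j_t,\alpha_t)\,\widetilde{\mathbf{V}}_t(j_t,\beta_t),\qquad \mathbf{W}_t=\mathbf{F}_{n_t}^{-1}\widetilde{\mathbf{W}}_t.$$ At the node $\{1,2\}$, let $\mathbf{M}=\mathbf{U}_2^\top\mathbf{V}_1\in\mathbb{R}^{r_2\times s_1}$ and define $$\mathscr{P}_{\{1,2\}}(\alpha_1,\beta_2,\phi(\gamma,\delta))=\sum_{\alpha_2=1}^{r_2}\sum_{\beta_1=1}^{s_1}\mathscr{G}_{\{1,2\}}(\alpha_1,\alpha_2,\gamma)\,\mathbf{M}(\alpha_2,\beta_1)\,\mathscr{H}_{\{1,2\}}(\beta_1,\beta_2,\delta).$$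 For any other internal node $\tau\in\mathcal{T}$ with children $\tau_1$ and $\tau_2$, define $$\mathscr{P}_\tau\bigl(\phi(\alpha_{\tau_1},\beta_{\tau_1}),\phi(\alpha_{\tau_2},\beta_{\tau_2}),\phi(\alpha_\tau,\beta_\tau)\bigr)=\mathscr{G}_\tau(\alpha_{\tau_1},\alpha_{\tau_2},\alpha_\tau)\,\mathscr{H}_\tau(\beta_{\tau_1},\beta_{\tau_2},\beta_\tau).$$ Then the higher-order tensor-tensor product $\mathscr{T}\star_H\mathscr{S}$ admits an HTD representation (with respect to $\mathcal{T}$) with leaf factors $\mathbf{W}_t$ and transfer tensors $\mathscr{P}_\tau$, whose hierarchical ranks are bounded by the products of the corresponding input ranks (at each node $\tau$, by $r_\tau s_\tau$).
   Context: A dimension tree $\mathcal{T}$ on $D=\{1,\dots,k\}$ is a rooted binary tree whose nodes are nonempty subsets of $D$, with root $D$, leaves the singletons $\{t\}$, and each internal node $\tau$ the disjoint union of its two (ordered) children $\tau_1,\tau_2$; the children of $\{1,2\}$ are $\{1\}$ and $\{2\}$. A $k$th-order tensor $\mathscr{X}$ of size $m_1\times\cdots\times m_k$ is in hierarchical Tucker (HTD) format with leaf factors $\mathbf{X}_t$ of size $m_t\times\rho_t$ ($\rho_{\{t\}}=\rho_t$), transfer tensors $\mathscr{B}_\tau$ of size $\rho_{\tau_1}\times\rho_{\tau_2}\times\rho_\tau$ and hierarchical ranks $\rho_\tau$ ($\rho_D=1$) if it is recovered by contracting transfer tensors and leaf factors over the tree: $$\mathscr{X}(i_1,\dots,i_k)=\sum_{(\alpha_\tau)_{\tau\in\mathcal{T}}}\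 \prod_{\tau\text{ internal}}\mathscr{B}_\tau(\alpha_{\tau_1},\alpha_{\tau_2},\alpha_\tau)\ \prod_{t=1}^k\mathbf{X}_t(i_t,\alpha_{\{t\}}),\quad 1\le\alpha_\tau\le\rho_\tau;$$ ranks are not required to be minimal, and the factors may be complex. Here $\alpha_t,\beta_t$ denote $\alpha_{\{t\}},\beta_{\{t\}}$, with $1\le\alpha_\tau\le r_\tau$, $1\le\beta_\tau\le s_\tau$, $1\le\gamma\le r_{\{1,2\}}$, $1\le\delta\le s_{\{1,2\}}$. $\mathbf{F}_n\in\mathbb{C}^{n\times n}$ is the discrete Fourier transform matrix $\mathbf{F}_n(p,q)=\frac{1}{\sqrt n}\omega^{(p-1)(q-1)}$, $\omega=\exp(-2\pi i/n)$. Mode-$p$ multiplication: $(\mathscr{X}\times_p\mathbf{A})(\dots,i,\dots)=\sum_{j_p}\mathbf{A}(i,j_p)\mathscr{X}(\dots,j_p,\dots)$. Facewise product: $(\mathscr{A}\,\Delta\,\mathscr{B})(:,:,j_3,\dots,j_k)=\mathscr{A}(:,:,j_3,\dots,j_k)\,\mathscr{B}(:,:,j_3,\dots,j_k)$ (matrix product). Higher-order tensor-tensor product: $\mathscr{T}\star_H\mathscr{S}=(\widetilde{\mathscr{T}}\,\Delta\,\widetilde{\mathscr{S}})\times_3\mathbf{F}_{n_3}^{-1}\times_4\cdots\times_k\mathbf{F}_{n_k}^{-1}$, where $\widetilde{\mathscr{T}}=\mathscr{T}\times_3\mathbf{F}_{n_3}\times_4\cdots\times_k\mathbf{F}_{n_k}$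 and $\widetilde{\mathscr{S}}=\mathscr{S}\times_3\mathbf{F}_{n_3}\times_4\cdots\times_k\mathbf{F}_{n_k}$. *)

theory Defs
  imports Complex_Main "HOL-Library.FuncSet" "Jordan_Normal_Form.Gauss_Jordan_Elimination"
begin

text \<open>
  Modes are numbered from 1, but all index ranges are 0-based, as for
  \<^typ>\<open>'a mat\<close>: an index running over \<open>1, ..., m\<close> on paper runs over \<open>{..<m}\<close> here.
  An order-\<open>k\<close> tensor of size \<open>m 1 \<times> ... \<times> m k\<close> is a function on multi-indices that is only
  meaningful on \<open>tensor_indices k m\<close>.
\<close>

type_synonym 'a tensor = "(nat \<Rightarrow> nat) \<Rightarrow> 'a"

definition tensor_indices :: "nat \<Rightarrow> (nat \<Rightarrow> nat) \<Rightarrow> (nat \<Rightarrow> nat) set" where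
  "tensor_indices k m = (\<Pi>\<^sub>E t\<in>{1..k}. {..<m t})"

text \<open>0-based form of \<open>a + (b - 1) p\<close>; \<open>p\<close> is the range of the first index.\<close>

definition phi :: "nat \<Rightarrow> nat \<Rightarrow> nat \<Rightarrow> nat" where
  "phi p a b = a + b * p"


subsection \<open>Dimension trees and the hierarchical Tucker format\<close>

text \<open>
  A tree is given by its set of nodes and the functions that send an internal node to its first
  and second child. Since children are proper subsets of their parent, the uniqueness of parents
  makes this a tree rooted at \<open>{1..k}\<close>.
\<close>

definition internal_nodes :: "nat set set \<Rightarrow> nat set set" where
  "internal_nodes \<T> = {\<tau> \<in> \<T>. \<forall>t. \<tau> \<noteq> {t}}"

definition dimension_tree ::
    "nat \<Rightarrow> nat set set \<Rightarrow> (nat set \<Rightarrow> nat set) \<Rightarrow> (nat set \<Rightarrow> nat set) \<Rightarrow> bool" where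
  "dimension_tree k \<T> c1 c2 \<longleftrightarrow>
     (\<forall>\<tau>\<in>\<T>. \<tau> \<noteq> {} \<and> \<tau> \<subseteq> {1..k}) \<and>
     {1..k} \<in> \<T> \<and>
     (\<forall>t\<in>{1..k}. {t} \<in> \<T>) \<and>
     (\<forall>\<tau>\<in>internal_nodes \<T>. c1 \<tau> \<in> \<T> \<and> c2 \<tau> \<in> \<T> \<and> c1 \<tau> \<inter> c2 \<tau> = {} \<and> c1 \<tau> \<union> c2 \<tau> = \<tau>) \<and>
     (\<forall>\<tau>\<in>\<T> - {{1..k}}. \<exists>!\<sigma>. \<sigma> \<in> internal_nodes \<T> \<and> (\<tau> = c1 \<sigma> \<or> \<tau> = c2 \<sigma>)) \<and>
     ({1, 2} \<in> \<T> \<longrightarrow> c1 {1, 2} = {1} \<and> c2 {1, 2} = {2})"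

text \<open>
  \<open>is_htd k m \<T> c1 c2 \<rho> X A B\<close>: the tensor \<open>X\<close> of size \<open>m 1 \<times> ... \<times> m k\<close> is represented by the
  leaf factors \<open>A t\<close> and the transfer tensors \<open>B \<tau>\<close>, with (not necessarily minimal) hierarchical
  ranks \<open>\<rho> \<tau>\<close>. The transfer tensor \<open>B \<tau>\<close> has size \<open>\<rho> (c1 \<tau>) \<times> \<rho> (c2 \<tau>) \<times> \<rho> \<tau>\<close>; only its
  entries in that range are used.
\<close>

definition is_htd ::
    "nat \<Rightarrow> (nat \<Rightarrow> nat) \<Rightarrow> nat set set \<Rightarrow> (nat set \<Rightarrow> nat set) \<Rightarrow> (nat set \<Rightarrow> nat set) \<Rightarrow>
     (nat set \<Rightarrow> nat) \<Rightarrow> complex tensor \<Rightarrow>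
     (nat \<Rightarrow> complex mat) \<Rightarrow> (nat set \<Rightarrow> nat \<Rightarrow> nat \<Rightarrow> nat \<Rightarrow> complex) \<Rightarrow> bool" where
  "is_htd k m \<T> c1 c2 \<rho> X A B \<longleftrightarrow>
     \<rho> {1..k} = 1 \<and>
     (\<forall>\<tau>\<in>\<T>. 1 \<le> \<rho> \<tau>) \<and>
     (\<forall>t\<in>{1..k}. A t \<in> carrier_mat (m t) (\<rho> {t})) \<and>
     (\<forall>i\<in>tensor_indices k m.
        X i = (\<Sum>\<alpha> \<in> (\<Pi>\<^sub>E \<tau>\<in>\<T>. {..<\<rho> \<tau>}).
                 (\<Prod>\<tau>\<in>internal_nodes \<T>. B \<tau> (\<alpha> (c1 \<tau>)) (\<alpha> (c2 \<tau>)) (\<alpha> \<tau>)) *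
                 (\<Prod>t\<in>{1..k}. A t $$ (i t, \<alpha> {t}))))"


subsection \<open>The higher-order tensor-tensor product\<close>

definition dft :: "nat \<Rightarrow> complex mat" where
  "dft n = mat n n (\<lambda>(p, q).
     1 / complex_of_real (sqrt (real n)) * exp (- 2 * complex_of_real pi * \<i> / of_nat n) ^ (p * q))"

definition mode_prod :: "nat \<Rightarrow> complex mat \<Rightarrow> complex tensor \<Rightarrow> complex tensor" where
  "mode_prod p A X = (\<lambda>i. \<Sum>j<dim_col A. A $$ (i p, j) * X (i(p := j)))"

text \<open>Successive mode products with \<open>A 3, ..., A k\<close> in modes \<open>3, ..., k\<close>, starting with mode 3.\<close>

definition mode_prods :: "nat \<Rightarrow> (nat \<Rightarrow> complex mat) \<Rightarrow> complex tensor \<Rightarrow> complex tensor" where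
  "mode_prods k A X = fold (\<lambda>t. mode_prod t (A t)) [3..<Suc k] X"

text \<open>\<open>l\<close> is the common size of the second mode of \<open>X\<close> and the first mode of \<open>Y\<close>.\<close>

definition facewise_prod :: "nat \<Rightarrow> complex tensor \<Rightarrow> complex tensor \<Rightarrow> complex tensor" where
  "facewise_prod l X Y = (\<lambda>i. \<Sum>j<l. X (i(2 := j)) * Y (i(1 := j)))"

text \<open>Only the sizes \<open>n t\<close> with \<open>3 \<le> t \<le> k\<close> matter here.\<close>

definition star_H ::
    "nat \<Rightarrow> (nat \<Rightarrow> nat) \<Rightarrow> nat \<Rightarrow> complex tensor \<Rightarrow> complex tensor \<Rightarrow> complex tensor" where
  "star_H k n l X Y =
     mode_prods k (\<lambda>t. the (mat_inverse (dft (n t))))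
       (facewise_prod l (mode_prods k (\<lambda>t. dft (n t)) X) (mode_prods k (\<lambda>t. dft (n t)) Y))"

end

theory Submission
  imports Defs "Jordan_Normal_Form.Determinant"
begin

text \<open>
  Mode products and the facewise product both respect the tree format. A mode product with a
  matrix is linear in one mode, and in a hierarchical Tucker sum that mode occurs in a single leaf
  factor only; hence it multiplies this leaf factor and leaves the rest of the representation
  alone (\<open>is_htd_mode_prod\<close>). The Fourier transforms and their inverses therefore act on the leaf
  factors of the modes \<open>3, ..., k\<close>, which leaves the facewise product to be represented.

  An entry of that product is a sum over \<open>j\<close> of products of two hierarchical Tucker sums, hence a
  sum over \<open>j\<close> and over pairs \<open>(\<alpha>, \<beta>)\<close> of index families. Since \<open>j\<close> only enters through the second leaf factor of
  the left tensor and the first of the right one, summing over \<open>j\<close> turns these two factors into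
  the entry \<open>M (\<alpha> {2}, \<beta> {1})\<close>. The indices \<open>\<alpha> {2}\<close> and \<open>\<beta> {1}\<close> then occur only in this entry
  and in the two transfer tensors at \<open>{1, 2}\<close>, because a leaf has only one parent
  (\<open>parent_of_first_two_leaves\<close>). Summing over them gives the transfer tensor \<open>P\<close> at \<open>{1, 2}\<close>.
  At all nodes except the leaves \<open>{1}\<close> and \<open>{2}\<close> the indices \<open>\<alpha> \<tau>\<close> and \<open>\<beta> \<tau>\<close> are merged by the
  bijection \<open>phi\<close>, and the remaining factors multiply entrywise. The change of summation indices is \<open>sum_merge\<close>, the
  representation itself \<open>is_htd_facewise_prod\<close>.

  The Fourier matrix enters only through being invertible: this is what gives
  \<open>the (mat_inverse (dft n))\<close> the size that the inverse mode products need.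
\<close>


section \<open>The Fourier matrix is invertible\<close>

lemma sum_powers_root_of_unity:
  fixes z :: complex
  assumes "z ^ n = 1" "z \<noteq> 1"
  shows "(\<Sum>j<n. z ^ j) = 0"
  using assms by (simp add: geometric_sum)

lemma dft_entry:
  assumes "p < n" "j < n"
  shows "dft n $$ (p, j) = cnj (cis (2 * pi * real p / real n)) ^ j / complex_of_real (sqrt (real n))"
proof -
  have "exp (- 2 * complex_of_real pi * \<i> / of_nat n) = cnj (cis (2 * pi / real n))"
    unfolding cis_cnj by (simp add: cis_conv_exp mult_ac)
  moreover have "cnj (cis (2 * pi / real n)) ^ p = cnj (cis (2 * pi * real p / real n))"
    by (simp add: DeMoivre mult_ac flip: complex_cnj_power)
  ultimately show ?thesis
    using assms by (simp add: dft_def power_mult)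
qed

text \<open>
  Orthogonality of characters: entry \<open>(p, q)\<close> of the product is the mean of the powers
  \<open>z ^ 0, ..., z ^ (n - 1)\<close> of an \<open>n\<close>-th root of unity \<open>z\<close> that equals 1 only for \<open>p = q\<close>. The second
  factor is the conjugate of the Fourier matrix, which is symmetric.
\<close>

lemma dft_mult_conjugate:
  "dft n * mat n n (\<lambda>(j, q). cis (2 * pi * real q / real n) ^ j / complex_of_real (sqrt (real n))) = 1\<^sub>m n"
    (is "_ * ?E = _")
proof (rule eq_matI)
  fix p q assume "p < dim_row (1\<^sub>m n :: complex mat)" "q < dim_col (1\<^sub>m n :: complex mat)"
  then have pq: "p < n" "q < n" by auto
  define \<zeta> where "\<zeta> j = cis (2 * pi * real j / real n)" for j
  define z where "z = cnj (\<zeta> p) * \<zeta> q"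
  have bij: "bij_betw \<zeta> {..<n} {z. z ^ n = 1}"
    unfolding \<zeta>_def using pq by (intro bij_betw_roots_unity) auto
  then have pow: "\<zeta> p ^ n = 1" "\<zeta> q ^ n = 1"
    using pq by (auto simp: bij_betw_def)
  have norm: "cnj (\<zeta> p) * \<zeta> p = 1"
    by (simp add: \<zeta>_def cis_mult cis_cnj)
  have "(dft n * ?E) $$ (p, q) = (\<Sum>j<n. dft n $$ (p, j) * ?E $$ (j, q))"
    using pq by (simp add: dft_def scalar_prod_def atLeast0LessThan)
  also have "\<dots> = (\<Sum>j<n. z ^ j / of_nat n)"
    using pq by (intro sum.cong)
      (simp_all add: dft_entry z_def \<zeta>_def power_mult_distrib flip: of_real_mult)
  also have "\<dots> = (\<Sum>j<n. z ^ j) / of_nat n"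
    by (simp add: sum_divide_distrib)
  also have "\<dots> = (1\<^sub>m n) $$ (p, q)"
  proof (cases "p = q")
    case True
    then show ?thesis using pq norm by (simp add: z_def)
  next
    case False
    have "z \<noteq> 1"
    proof
      assume "z = 1"
      then have "\<zeta> p = \<zeta> p * z" by simp
      also have "\<dots> = cnj (\<zeta> p) * \<zeta> p * \<zeta> q" by (simp add: z_def)
      finally have "\<zeta> p = \<zeta> q" by (simp add: norm)
      with bij pq False show False by (auto simp: bij_betw_def inj_on_def)
    qed
    moreover have "z ^ n = 1"
      using pow by (simp add: z_def power_mult_distrib flip: complex_cnj_power)
    ultimately show ?thesis
      using False pq by (simp add: sum_powers_root_of_unity)
  qed
  finally show "(dft n * ?E) $$ (p, q) = (1\<^sub>m n) $$ (p, q)" .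
qed (simp_all add: dft_def)

lemma dft_carrier: "dft n \<in> carrier_mat n n"
  by (simp add: dft_def)

lemma mat_inverse_dft_carrier: "the (mat_inverse (dft n)) \<in> carrier_mat n n"
proof (cases "mat_inverse (dft n)")
  case None
  let ?E = "mat n n (\<lambda>(j, q). cis (2 * pi * real q / real n) ^ j / complex_of_real (sqrt (real n)))"
  have "?E * dft n = 1\<^sub>m n"
    by (rule mat_mult_left_right_inverse[OF dft_carrier _ dft_mult_conjugate]) simp
  then have "dft n \<in> Units (ring_mat TYPE(complex) n ())"
    using dft_mult_conjugate[of n] dft_carrier[of n]
    by (auto simp: Units_def ring_mat_simps intro!: bexI[of _ ?E])
  with mat_inverse(1)[OF dft_carrier None, of "()"] show ?thesis by blast
next
  case (Some B)
  with mat_inverse(2)[OF dft_carrier Some] show ?thesis by simp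
qed


section \<open>Mode products act on the leaf factors\<close>

lemma tensor_indices_upd:
  assumes "i \<in> tensor_indices k (m(p := d))" "p \<in> {1..k}" "j < d'"
  shows "i(p := j) \<in> tensor_indices k (m(p := d'))"
  using assms by (auto simp: tensor_indices_def PiE_iff extensional_def)

text \<open>
  The factor \<open>A p $$ (i p, \<alpha> {p})\<close> is the only part of each summand that depends on the index in
  mode \<open>p\<close>, so the sum over that index can be moved inside and completes \<open>A p\<close> to \<open>F * A p\<close>.
\<close>

lemma is_htd_mode_prod:
  assumes X: "is_htd k m \<T> c1 c2 \<rho> X A B"
    and p: "p \<in> {1..k}" "{p} \<in> \<T>" and F: "F \<in> carrier_mat d (m p)"
  shows "is_htd k (m(p := d)) \<T> c1 c2 \<rho> (mode_prod p F X) (A(p := F * A p)) B"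
proof -
  have A: "A p \<in> carrier_mat (m p) (\<rho> {p})"
    using X p by (auto simp: is_htd_def)
  have "mode_prod p F X i =
      (\<Sum>\<alpha> \<in> (\<Pi>\<^sub>E \<tau>\<in>\<T>. {..<\<rho> \<tau>}).
         (\<Prod>\<tau>\<in>internal_nodes \<T>. B \<tau> (\<alpha> (c1 \<tau>)) (\<alpha> (c2 \<tau>)) (\<alpha> \<tau>)) *
         (\<Prod>t\<in>{1..k}. (A(p := F * A p)) t $$ (i t, \<alpha> {t})))"
    if i: "i \<in> tensor_indices k (m(p := d))" for i
  proof -
    let ?I = "\<Pi>\<^sub>E \<tau>\<in>\<T>. {..<\<rho> \<tau>}"
    let ?B = "\<lambda>\<alpha>. \<Prod>\<tau>\<in>internal_nodes \<T>. B \<tau> (\<alpha> (c1 \<tau>)) (\<alpha> (c2 \<tau>)) (\<alpha> \<tau>)"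
    let ?R = "\<lambda>\<alpha>. \<Prod>t\<in>{1..k} - {p}. A t $$ (i t, \<alpha> {t})"
    have ip: "i p < d"
      using i p(1) by (auto simp: tensor_indices_def dest: PiE_mem[where x = p])
    have split: "(\<Prod>t\<in>{1..k}. f t) = f p * (\<Prod>t\<in>{1..k} - {p}. f t)" for f :: "nat \<Rightarrow> complex"
      using p by (simp add: prod.remove)
    have X_i: "X (i(p := j)) = (\<Sum>\<alpha>\<in>?I. ?B \<alpha> * (A p $$ (j, \<alpha> {p}) * ?R \<alpha>))" if "j < m p" for j
    proof -
      have "i(p := j) \<in> tensor_indices k m"
        using tensor_indices_upd[OF i p(1) that] by simp
      with X have "X (i(p := j)) = (\<Sum>\<alpha>\<in>?I. ?B \<alpha> * (\<Prod>t\<in>{1..k}. A t $$ ((i(p := j)) t, \<alpha> {t})))"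
        by (simp add: is_htd_def)
      moreover have "(\<Prod>t\<in>{1..k} - {p}. A t $$ ((i(p := j)) t, \<alpha> {t})) = ?R \<alpha>" for \<alpha>
        by (intro prod.cong) auto
      ultimately show ?thesis
        unfolding split by simp
    qed
    have leaf: "(F * A p) $$ (i p, \<alpha> {p}) = (\<Sum>j<m p. F $$ (i p, j) * A p $$ (j, \<alpha> {p}))"
      if "\<alpha> \<in> ?I" for \<alpha>
    proof -
      have "\<alpha> {p} < \<rho> {p}" using that p by (auto simp: PiE_iff)
      then show ?thesis
        using ip F A by (simp add: scalar_prod_def atLeast0LessThan)
    qed
    have "mode_prod p F X i = (\<Sum>j<m p. F $$ (i p, j) * (\<Sum>\<alpha>\<in>?I. ?B \<alpha> * (A p $$ (j, \<alpha> {p}) * ?R \<alpha>)))"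
      using F X_i by (simp add: mode_prod_def)
    also have "\<dots> = (\<Sum>\<alpha>\<in>?I. \<Sum>j<m p. F $$ (i p, j) * (?B \<alpha> * (A p $$ (j, \<alpha> {p}) * ?R \<alpha>)))"
      unfolding sum_distrib_left by (rule sum.swap)
    also have "\<dots> = (\<Sum>\<alpha>\<in>?I. ?B \<alpha> * ((F * A p) $$ (i p, \<alpha> {p}) * ?R \<alpha>))"
      by (intro sum.cong refl) (simp add: leaf sum_distrib_left sum_distrib_right mult_ac)
    also have "\<dots> = (\<Sum>\<alpha>\<in>?I. ?B \<alpha> * (\<Prod>t\<in>{1..k}. (A(p := F * A p)) t $$ (i t, \<alpha> {t})))"
      unfolding split by (intro sum.cong refl arg_cong2[where f = "(*)"] prod.cong) auto
    finally show ?thesis .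
  qed
  moreover have "(A(p := F * A p)) t \<in> carrier_mat ((m(p := d)) t) (\<rho> {t})" if "t \<in> {1..k}" for t
    using X F A that by (auto simp: is_htd_def)
  ultimately show ?thesis
    using X by (auto simp: is_htd_def)
qed

lemma is_htd_mode_prods:
  assumes X: "is_htd k m \<T> c1 c2 \<rho> X A B"
    and leaves: "\<forall>t\<in>{1..k}. {t} \<in> \<T>"
    and F: "\<And>t. t \<in> {3..k} \<Longrightarrow> F t \<in> carrier_mat (m t) (m t)"
  shows "is_htd k m \<T> c1 c2 \<rho> (mode_prods k F X) (\<lambda>t. if t \<in> {3..k} then F t * A t else A t) B"
proof -
  have "is_htd k m \<T> c1 c2 \<rho> (fold (\<lambda>t. mode_prod t (F t)) ts X)
          (\<lambda>t. if t \<in> set ts then F t * A t else A t) B"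
    if "distinct ts" "set ts \<subseteq> {3..k}" for ts
    using that
  proof (induction ts rule: rev_induct)
    case Nil
    then show ?case using X by simp
  next
    case (snoc p ts)
    let ?A = "\<lambda>t. if t \<in> set ts then F t * A t else A t"
    have p: "p \<in> {3..k}" "p \<notin> set ts" using snoc.prems by auto
    have "is_htd k m \<T> c1 c2 \<rho> (fold (\<lambda>t. mode_prod t (F t)) ts X) ?A B"
      using snoc by simp
    then have "is_htd k (m(p := m p)) \<T> c1 c2 \<rho>
        (mode_prod p (F p) (fold (\<lambda>t. mode_prod t (F t)) ts X)) (?A(p := F p * ?A p)) B"
      using p leaves F by (intro is_htd_mode_prod) auto
    moreover have "?A(p := F p * ?A p) = (\<lambda>t. if t \<in> set (ts @ [p]) then F t * A t else A t)"
      using p by auto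
    ultimately show ?case by simp
  qed
  from this[of "[3..<Suc k]"] show ?thesis
    by (simp add: mode_prods_def atLeastLessThanSuc_atLeastAtMost del: upt_Suc)
qed


section \<open>Merging the index families of two representations\<close>

lemma phi_less:
  assumes "a < p" "b < s"
  shows "phi p a b < p * s"
proof -
  have "a + b * p < Suc b * p" using assms by simp
  also have "\<dots> \<le> s * p" using assms by (intro mult_right_mono) auto
  finally show ?thesis by (simp add: phi_def mult.commute)
qed

lemma phi_mod_div: "phi p (c mod p) (c div p) = c"
  by (simp add: phi_def)

lemma mod_div_phi:
  assumes "a < p"
  shows "phi p a b mod p = a" "phi p a b div p = b"
  using assms by (simp_all add: phi_def)

text \<open>
  The pair \<open>(\<alpha>, \<beta>)\<close> of index families corresponds to the merged family \<open>\<zeta>\<close> together with the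
  two indices \<open>a = \<alpha> {2}\<close> and \<open>b = \<beta> {1}\<close> that \<open>\<zeta>\<close> does not record: \<open>\<zeta>\<close> keeps \<open>\<alpha>\<close> at \<open>{1}\<close>, \<open>\<beta>\<close> at
  \<open>{2}\<close> and \<open>phi (r \<tau>) (\<alpha> \<tau>) (\<beta> \<tau>)\<close> at every other node. The two functions below recover
  \<open>\<alpha>\<close> and \<open>\<beta>\<close>, undoing \<open>phi\<close> by division with remainder.
\<close>

definition left_part :: "(nat set \<Rightarrow> nat) \<Rightarrow> nat set set \<Rightarrow> (nat set \<Rightarrow> nat) \<Rightarrow> nat \<Rightarrow> nat set \<Rightarrow> nat" where
  "left_part r \<T> \<zeta> a =
     (\<lambda>\<tau>\<in>\<T>. if \<tau> = {1} then \<zeta> {1} else if \<tau> = {2} then a else \<zeta> \<tau> mod r \<tau>)"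

definition right_part :: "(nat set \<Rightarrow> nat) \<Rightarrow> nat set set \<Rightarrow> (nat set \<Rightarrow> nat) \<Rightarrow> nat \<Rightarrow> nat set \<Rightarrow> nat" where
  "right_part r \<T> \<zeta> b =
     (\<lambda>\<tau>\<in>\<T>. if \<tau> = {1} then b else if \<tau> = {2} then \<zeta> {2} else \<zeta> \<tau> div r \<tau>)"

definition prod_rank :: "(nat set \<Rightarrow> nat) \<Rightarrow> (nat set \<Rightarrow> nat) \<Rightarrow> nat set \<Rightarrow> nat" where
  "prod_rank r s = (\<lambda>\<tau>. if \<tau> = {1} then r {1} else if \<tau> = {2} then s {2} else r \<tau> * s \<tau>)"

lemma left_part_in:
  assumes "\<zeta> \<in> (\<Pi>\<^sub>E \<tau>\<in>\<T>. {..<prod_rank r s \<tau>})" "a < r {2}" "\<forall>\<tau>\<in>\<T>. 1 \<le> r \<tau>"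
  shows "left_part r \<T> \<zeta> a \<in> (\<Pi>\<^sub>E \<tau>\<in>\<T>. {..<r \<tau>})"
  using assms by (fastforce simp: left_part_def prod_rank_def PiE_iff split: if_splits)

lemma right_part_in:
  assumes "\<zeta> \<in> (\<Pi>\<^sub>E \<tau>\<in>\<T>. {..<prod_rank r s \<tau>})" "b < s {1}"
  shows "right_part r \<T> \<zeta> b \<in> (\<Pi>\<^sub>E \<tau>\<in>\<T>. {..<s \<tau>})"
  using assms
  by (fastforce simp: right_part_def prod_rank_def PiE_iff less_mult_imp_div_less mult.commute
      split: if_splits)

text \<open>
  This is a pure change of variables, valid for every summand \<open>h\<close>. The sums over \<open>a\<close> and \<open>b\<close> are
  innermost since they become the two sums in the transfer tensor at \<open>{1, 2}\<close>.
\<close>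

lemma sum_merge:
  fixes h :: "(nat set \<Rightarrow> nat) \<Rightarrow> (nat set \<Rightarrow> nat) \<Rightarrow> 'a :: comm_monoid_add"
  assumes T: "{1} \<in> \<T>" "{2} \<in> \<T>" and r: "\<forall>\<tau>\<in>\<T>. 1 \<le> r \<tau>"
  shows "(\<Sum>\<alpha> \<in> (\<Pi>\<^sub>E \<tau>\<in>\<T>. {..<r \<tau>}). \<Sum>\<beta> \<in> (\<Pi>\<^sub>E \<tau>\<in>\<T>. {..<s \<tau>}). h \<alpha> \<beta>) =
         (\<Sum>\<zeta> \<in> (\<Pi>\<^sub>E \<tau>\<in>\<T>. {..<prod_rank r s \<tau>}). \<Sum>a<r {2}. \<Sum>b<s {1}.
            h (left_part r \<T> \<zeta> a) (right_part r \<T> \<zeta> b))"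
proof -
  let ?A = "\<Pi>\<^sub>E \<tau>\<in>\<T>. {..<r \<tau>}" and ?B = "\<Pi>\<^sub>E \<tau>\<in>\<T>. {..<s \<tau>}"
  let ?Z = "\<Pi>\<^sub>E \<tau>\<in>\<T>. {..<prod_rank r s \<tau>}"
  define split where "split = (\<lambda>(\<zeta>, a, b). (left_part r \<T> \<zeta> a, right_part r \<T> \<zeta> b))"
  define join where "join = (\<lambda>(\<alpha> :: nat set \<Rightarrow> nat, \<beta> :: nat set \<Rightarrow> nat).
      ((\<lambda>\<tau>\<in>\<T>. if \<tau> = {1} then \<alpha> {1} else if \<tau> = {2} then \<beta> {2} else phi (r \<tau>) (\<alpha> \<tau>) (\<beta> \<tau>)),
       \<alpha> {2}, \<beta> {1}))"
  have "(\<Sum>x\<in>?A \<times> ?B. case x of (\<alpha>, \<beta>) \<Rightarrow> h \<alpha> \<beta>) =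
        (\<Sum>y\<in>?Z \<times> {..<r {2}} \<times> {..<s {1}}.
           case y of (\<zeta>, a, b) \<Rightarrow> h (left_part r \<T> \<zeta> a) (right_part r \<T> \<zeta> b))"
  proof (rule sum.reindex_bij_witness[of _ split join])
    fix x assume "x \<in> ?A \<times> ?B"
    then obtain \<alpha> \<beta> where x: "x = (\<alpha>, \<beta>)" and \<alpha>: "\<alpha> \<in> ?A" and \<beta>: "\<beta> \<in> ?B" by auto
    have eq: "left_part r \<T> (fst (join x)) (\<alpha> {2}) = \<alpha>"
      using \<alpha> T by (auto simp: fun_eq_iff left_part_def join_def x mod_div_phi PiE_iff
          extensional_def restrict_def)
    moreover have eq': "right_part r \<T> (fst (join x)) (\<beta> {1}) = \<beta>"
      using \<alpha> \<beta> T by (auto simp: fun_eq_iff right_part_def join_def x mod_div_phi PiE_iff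
          extensional_def restrict_def)
    ultimately show "split (join x) = x"
      by (simp add: split_def join_def x)
    show "join x \<in> ?Z \<times> {..<r {2}} \<times> {..<s {1}}"
      using \<alpha> \<beta> T by (auto simp: join_def x prod_rank_def PiE_iff phi_less)
    show "(case join x of (\<zeta>, a, b) \<Rightarrow> h (left_part r \<T> \<zeta> a) (right_part r \<T> \<zeta> b)) =
          (case x of (\<alpha>, \<beta>) \<Rightarrow> h \<alpha> \<beta>)"
      using eq eq' by (simp add: join_def x)
  next
    fix y assume "y \<in> ?Z \<times> {..<r {2}} \<times> {..<s {1}}"
    then obtain \<zeta> a b where y: "y = (\<zeta>, a, b)" and \<zeta>: "\<zeta> \<in> ?Z" and ab: "a < r {2}" "b < s {1}"
      by auto
    show "join (split y) = y"
      using \<zeta> T by (auto simp: fun_eq_iff left_part_def right_part_def join_def split_def y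
          phi_mod_div PiE_iff extensional_def restrict_def)
    show "split y \<in> ?A \<times> ?B"
      using \<zeta> ab r by (simp add: split_def y left_part_in right_part_in)
  qed
  then show ?thesis
    by (simp add: sum.cartesian_product)
qed


section \<open>The facewise product\<close>

text \<open>
  At nodes other than \<open>{1, 2}\<close> the merged transfer tensors only make sense if both children carry
  indices merged by \<open>phi\<close>. The two leaves that do not are already children of \<open>{1, 2}\<close>, and parents
  are unique; \<open>3 \<le> k\<close> guarantees that neither leaf is the root.
\<close>

lemma parent_of_first_two_leaves:
  assumes tree: "dimension_tree k \<T> c1 c2" and k: "3 \<le> k" and T: "{1, 2} \<in> \<T>"
    and \<tau>: "\<tau> \<in> internal_nodes \<T>" "\<tau> \<noteq> {1, 2}"
  shows "c1 \<tau> \<notin> {{1}, {2}}" "c2 \<tau> \<notin> {{1}, {2}}"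
proof -
  have int: "{1, 2} \<in> internal_nodes \<T>"
    using T by (auto simp: internal_nodes_def)
  have ch: "c1 {1, 2} = {1}" "c2 {1, 2} = {2}"
    using tree T by (simp_all add: dimension_tree_def)
  have unique: "\<tau> = {1, 2}" if t: "t \<in> {1, 2}" and parent: "{t} = c1 \<tau> \<or> {t} = c2 \<tau>" for t
  proof -
    have "{t} \<in> \<T>" "{t} \<noteq> {1..k}"
      using t k tree by (auto simp: dimension_tree_def dest: arg_cong[of _ _ card])
    then have "\<exists>!\<sigma>. \<sigma> \<in> internal_nodes \<T> \<and> ({t} = c1 \<sigma> \<or> {t} = c2 \<sigma>)"
      using tree by (simp add: dimension_tree_def)
    moreover have "\<tau> \<in> internal_nodes \<T> \<and> ({t} = c1 \<tau> \<or> {t} = c2 \<tau>)"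
      using \<tau>(1) parent by (rule conjI)
    moreover have "{1, 2} \<in> internal_nodes \<T> \<and> ({t} = c1 {1, 2} \<or> {t} = c2 {1, 2})"
      using int t unfolding ch by auto
    ultimately show ?thesis
      by (elim ex1E) metis
  qed
  show "c1 \<tau> \<notin> {{1}, {2}}" "c2 \<tau> \<notin> {{1}, {2}}"
    using unique[of 1] unique[of 2] \<tau>(2) by auto
qed

lemma prod_leaves:
  fixes f :: "nat \<Rightarrow> complex"
  assumes "3 \<le> k"
  shows "(\<Prod>t\<in>{1..k}. f t) = f 1 * f 2 * (\<Prod>t\<in>{3..k}. f t)"
proof -
  have "{1..k} = insert 1 (insert 2 {3..k})" using assms by auto
  then show ?thesis by (simp add: mult.assoc)
qed

text \<open>
  Here the leaf factors in the modes \<open>3, ..., k\<close> are arbitrary; they will be the Fourier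
  transformed ones.
\<close>

lemma is_htd_facewise_prod:
  assumes k: "3 \<le> k"
    and tree: "dimension_tree k \<T> c1 c2" and T: "{1, 2} \<in> \<T>"
    and X: "is_htd k (n(2 := l)) \<T> c1 c2 r X U G"
    and Y: "is_htd k (n(1 := l)) \<T> c1 c2 s Y V H"
    and W1: "W 1 = U 1" and W2: "W 2 = V 2"
    and W_carrier: "\<And>t. t \<in> {3..k} \<Longrightarrow> W t \<in> carrier_mat (n t) (r {t} * s {t})"
    and W: "\<And>t j \<alpha> \<beta>. t \<in> {3..k} \<Longrightarrow> j < n t \<Longrightarrow> \<alpha> < r {t} \<Longrightarrow> \<beta> < s {t} \<Longrightarrow>
           W t $$ (j, phi (r {t}) \<alpha> \<beta>) = U t $$ (j, \<alpha>) * V t $$ (j, \<beta>)"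
    and M: "M = transpose_mat (U 2) * V 1"
    and P12: "\<And>\<alpha>\<^sub>1 \<beta>\<^sub>2 \<gamma> \<delta>. \<alpha>\<^sub>1 < r {1} \<Longrightarrow> \<beta>\<^sub>2 < s {2} \<Longrightarrow> \<gamma> < r {1, 2} \<Longrightarrow> \<delta> < s {1, 2} \<Longrightarrow>
           P {1, 2} \<alpha>\<^sub>1 \<beta>\<^sub>2 (phi (r {1, 2}) \<gamma> \<delta>) =
             (\<Sum>\<alpha>\<^sub>2<r {2}. \<Sum>\<beta>\<^sub>1<s {1}. G {1, 2} \<alpha>\<^sub>1 \<alpha>\<^sub>2 \<gamma> * M $$ (\<alpha>\<^sub>2, \<beta>\<^sub>1) * H {1, 2} \<beta>\<^sub>1 \<beta>\<^sub>2 \<delta>)"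
    and P: "\<And>\<tau> \<alpha>\<^sub>1 \<beta>\<^sub>1 \<alpha>\<^sub>2 \<beta>\<^sub>2 \<alpha> \<beta>. \<tau> \<in> internal_nodes \<T> \<Longrightarrow> \<tau> \<noteq> {1, 2} \<Longrightarrow>
           \<alpha>\<^sub>1 < r (c1 \<tau>) \<Longrightarrow> \<beta>\<^sub>1 < s (c1 \<tau>) \<Longrightarrow> \<alpha>\<^sub>2 < r (c2 \<tau>) \<Longrightarrow> \<beta>\<^sub>2 < s (c2 \<tau>) \<Longrightarrow>
           \<alpha> < r \<tau> \<Longrightarrow> \<beta> < s \<tau> \<Longrightarrow>
           P \<tau> (phi (r (c1 \<tau>)) \<alpha>\<^sub>1 \<beta>\<^sub>1) (phi (r (c2 \<tau>)) \<alpha>\<^sub>2 \<beta>\<^sub>2) (phi (r \<tau>) \<alpha> \<beta>) =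
             G \<tau> \<alpha>\<^sub>1 \<alpha>\<^sub>2 \<alpha> * H \<tau> \<beta>\<^sub>1 \<beta>\<^sub>2 \<beta>"
  shows "is_htd k n \<T> c1 c2 (prod_rank r s) (facewise_prod l X Y) W P"
proof -
  let ?A = "\<Pi>\<^sub>E \<tau>\<in>\<T>. {..<r \<tau>}" and ?B = "\<Pi>\<^sub>E \<tau>\<in>\<T>. {..<s \<tau>}"
  let ?Z = "\<Pi>\<^sub>E \<tau>\<in>\<T>. {..<prod_rank r s \<tau>}"
  let ?N = "internal_nodes \<T> - {{1, 2}}"
  have leaf: "{t} \<in> \<T>" if "t \<in> {1..k}" for t
    using tree that by (simp add: dimension_tree_def)
  have T12: "{1} \<in> \<T>" "{2} \<in> \<T>" using leaf k by auto
  have r: "\<forall>\<tau>\<in>\<T>. 1 \<le> r \<tau>" and s: "\<forall>\<tau>\<in>\<T>. 1 \<le> s \<tau>"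
    using X Y by (simp_all add: is_htd_def)
  have U: "U t \<in> carrier_mat ((n(2 := l)) t) (r {t})" and V: "V t \<in> carrier_mat ((n(1 := l)) t) (s {t})"
    if "t \<in> {1..k}" for t
    using X Y that by (simp_all add: is_htd_def)
  have U2: "U 2 \<in> carrier_mat l (r {2})" and V1: "V 1 \<in> carrier_mat l (s {1})"
    using U[of 2] V[of 1] k by auto
  have int12: "{1, 2} \<in> internal_nodes \<T>"
    using T by (auto simp: internal_nodes_def)
  have "\<T> \<subseteq> Pow {1..k}"
    using tree by (auto simp: dimension_tree_def)
  then have "finite \<T>"
    by (rule finite_subset) simp
  then have fin: "finite (internal_nodes \<T>)"
    by (simp add: internal_nodes_def)
  have ch12: "c1 {1, 2} = {1}" "c2 {1, 2} = {2}"
    using tree T by (simp_all add: dimension_tree_def)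
  have split: "(\<Prod>\<tau>\<in>internal_nodes \<T>. f \<tau>) = f {1, 2} * (\<Prod>\<tau>\<in>?N. f \<tau>)" for f :: "nat set \<Rightarrow> complex"
    using fin int12 by (simp add: prod.remove)
  have "facewise_prod l X Y i =
      (\<Sum>\<zeta>\<in>?Z. (\<Prod>\<tau>\<in>internal_nodes \<T>. P \<tau> (\<zeta> (c1 \<tau>)) (\<zeta> (c2 \<tau>)) (\<zeta> \<tau>)) *
         (\<Prod>t\<in>{1..k}. W t $$ (i t, \<zeta> {t})))"
    if i: "i \<in> tensor_indices k n" for i
  proof -
    let ?GN = "\<lambda>\<alpha>. \<Prod>\<tau>\<in>?N. G \<tau> (\<alpha> (c1 \<tau>)) (\<alpha> (c2 \<tau>)) (\<alpha> \<tau>)"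
    let ?HN = "\<lambda>\<beta>. \<Prod>\<tau>\<in>?N. H \<tau> (\<beta> (c1 \<tau>)) (\<beta> (c2 \<tau>)) (\<beta> \<tau>)"
    let ?UL = "\<lambda>\<alpha>. \<Prod>t\<in>{3..k}. U t $$ (i t, \<alpha> {t})"
    let ?VL = "\<lambda>\<beta>. \<Prod>t\<in>{3..k}. V t $$ (i t, \<beta> {t})"
    \<comment> \<open>What remains of the summands of \<open>X\<close> and \<open>Y\<close> after removing the two leaf factors that
      depend on the contracted index \<open>j\<close>.\<close>
    define x where "x \<alpha> = G {1, 2} (\<alpha> {1}) (\<alpha> {2}) (\<alpha> {1, 2}) * ?GN \<alpha> * (U 1 $$ (i 1, \<alpha> {1}) * ?UL \<alpha>)" for \<alpha>
    define y where "y \<beta> = H {1, 2} (\<beta> {1}) (\<beta> {2}) (\<beta> {1, 2}) * ?HN \<beta> * (V 2 $$ (i 2, \<beta> {2}) * ?VL \<beta>)" for \<beta>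
    have X_i: "X (i(2 := j)) = (\<Sum>\<alpha>\<in>?A. x \<alpha> * U 2 $$ (j, \<alpha> {2}))" if "j < l" for j
    proof -
      have "i(2 := j) \<in> tensor_indices k (n(2 := l))"
        using tensor_indices_upd[of i k n 2 "n 2" j l] i k that by simp
      with X have "X (i(2 := j)) = (\<Sum>\<alpha>\<in>?A.
          (\<Prod>\<tau>\<in>internal_nodes \<T>. G \<tau> (\<alpha> (c1 \<tau>)) (\<alpha> (c2 \<tau>)) (\<alpha> \<tau>)) *
          (\<Prod>t\<in>{1..k}. U t $$ ((i(2 := j)) t, \<alpha> {t})))"
        by (simp add: is_htd_def)
      moreover have "(\<Prod>t\<in>{3..k}. U t $$ ((i(2 := j)) t, \<alpha> {t})) =
          (\<Prod>t\<in>{3..k}. U t $$ (i t, \<alpha> {t}))" for \<alpha>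
        by (intro prod.cong) auto
      ultimately show ?thesis
        unfolding split prod_leaves[OF k] ch12 x_def by (simp add: mult_ac)
    qed
    have Y_i: "Y (i(1 := j)) = (\<Sum>\<beta>\<in>?B. y \<beta> * V 1 $$ (j, \<beta> {1}))" if "j < l" for j
    proof -
      have "i(1 := j) \<in> tensor_indices k (n(1 := l))"
        using tensor_indices_upd[of i k n 1 "n 1" j l] i k that by simp
      with Y have "Y (i(1 := j)) = (\<Sum>\<beta>\<in>?B.
          (\<Prod>\<tau>\<in>internal_nodes \<T>. H \<tau> (\<beta> (c1 \<tau>)) (\<beta> (c2 \<tau>)) (\<beta> \<tau>)) *
          (\<Prod>t\<in>{1..k}. V t $$ ((i(1 := j)) t, \<beta> {t})))"
        by (simp add: is_htd_def)
      moreover have "(\<Prod>t\<in>{3..k}. V t $$ ((i(1 := j)) t, \<beta> {t})) =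
          (\<Prod>t\<in>{3..k}. V t $$ (i t, \<beta> {t}))" for \<beta>
        by (intro prod.cong) auto
      ultimately show ?thesis
        unfolding split prod_leaves[OF k] ch12 y_def by (simp add: mult_ac)
    qed
    have M_entry: "M $$ (a, b) = (\<Sum>j<l. U 2 $$ (j, a) * V 1 $$ (j, b))"
      if "a < r {2}" "b < s {1}" for a b
      using that U2 V1 by (simp add: M scalar_prod_def atLeast0LessThan)
    have "facewise_prod l X Y i =
        (\<Sum>j<l. (\<Sum>\<alpha>\<in>?A. x \<alpha> * U 2 $$ (j, \<alpha> {2})) * (\<Sum>\<beta>\<in>?B. y \<beta> * V 1 $$ (j, \<beta> {1})))"
      using X_i Y_i by (simp add: facewise_prod_def)
    also have "\<dots> = (\<Sum>j<l. \<Sum>\<alpha>\<in>?A. \<Sum>\<beta>\<in>?B. x \<alpha> * U 2 $$ (j, \<alpha> {2}) * (y \<beta> * V 1 $$ (j, \<beta> {1})))"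
      by (simp add: sum_product)
    also have "\<dots> = (\<Sum>\<alpha>\<in>?A. \<Sum>\<beta>\<in>?B. \<Sum>j<l. x \<alpha> * U 2 $$ (j, \<alpha> {2}) * (y \<beta> * V 1 $$ (j, \<beta> {1})))"
      by (subst sum.swap) (intro sum.cong refl sum.swap)
    also have "\<dots> = (\<Sum>\<alpha>\<in>?A. \<Sum>\<beta>\<in>?B. x \<alpha> * y \<beta> * M $$ (\<alpha> {2}, \<beta> {1}))"
    proof (intro sum.cong refl)
      fix \<alpha> \<beta> assume "\<alpha> \<in> ?A" "\<beta> \<in> ?B"
      then have "\<alpha> {2} < r {2}" "\<beta> {1} < s {1}" using T12 by (auto simp: PiE_iff)
      then show "(\<Sum>j<l. x \<alpha> * U 2 $$ (j, \<alpha> {2}) * (y \<beta> * V 1 $$ (j, \<beta> {1}))) =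
          x \<alpha> * y \<beta> * M $$ (\<alpha> {2}, \<beta> {1})"
        by (simp add: M_entry sum_distrib_left mult_ac)
    qed
    also have "\<dots> = (\<Sum>\<zeta>\<in>?Z. \<Sum>a<r {2}. \<Sum>b<s {1}.
        x (left_part r \<T> \<zeta> a) * y (right_part r \<T> \<zeta> b) *
        M $$ (left_part r \<T> \<zeta> a {2}, right_part r \<T> \<zeta> b {1}))"
      by (rule sum_merge[OF T12 r])
    also have "\<dots> = (\<Sum>\<zeta>\<in>?Z. (\<Prod>\<tau>\<in>internal_nodes \<T>. P \<tau> (\<zeta> (c1 \<tau>)) (\<zeta> (c2 \<tau>)) (\<zeta> \<tau>)) *
         (\<Prod>t\<in>{1..k}. W t $$ (i t, \<zeta> {t})))"
    proof (intro sum.cong refl)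
      fix \<zeta> assume \<zeta>: "\<zeta> \<in> ?Z"
      define PN where "PN = (\<Prod>\<tau>\<in>?N. P \<tau> (\<zeta> (c1 \<tau>)) (\<zeta> (c2 \<tau>)) (\<zeta> \<tau>))"
      define WL where "WL = (\<Prod>t\<in>{3..k}. W t $$ (i t, \<zeta> {t}))"
      define g where "g = \<zeta> {1, 2} mod r {1, 2}"
      define d where "d = \<zeta> {1, 2} div r {1, 2}"
      have ne: "{1, 2} \<noteq> {1::nat}" "{1, 2} \<noteq> {2::nat}" "{1::nat} \<noteq> {2}" by auto
      \<comment> \<open>Only the first bracket depends on \<open>a\<close> and \<open>b\<close>, so its double sum is the entry of \<open>P\<close> at
        \<open>{1, 2}\<close>.\<close>
      have term_eq: "x (left_part r \<T> \<zeta> a) * y (right_part r \<T> \<zeta> b) *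
            M $$ (left_part r \<T> \<zeta> a {2}, right_part r \<T> \<zeta> b {1}) =
          (G {1, 2} (\<zeta> {1}) a g * M $$ (a, b) * H {1, 2} b (\<zeta> {2}) d) *
          (PN * (U 1 $$ (i 1, \<zeta> {1}) * V 2 $$ (i 2, \<zeta> {2}) * WL))"
        if a: "a < r {2}" and b: "b < s {1}" for a b
      proof -
        define \<alpha> where "\<alpha> = left_part r \<T> \<zeta> a"
        define \<beta> where "\<beta> = right_part r \<T> \<zeta> b"
        have "\<alpha> \<in> ?A" "\<beta> \<in> ?B"
          using left_part_in[OF \<zeta> a r] right_part_in[OF \<zeta> b] by (simp_all add: \<alpha>_def \<beta>_def)
        then have bd: "\<alpha> \<tau> < r \<tau>" "\<beta> \<tau> < s \<tau>" if "\<tau> \<in> \<T>" for \<tau>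
          using that by (auto simp: PiE_iff)
        have merged: "\<zeta> \<tau> = phi (r \<tau>) (\<alpha> \<tau>) (\<beta> \<tau>)" if "\<tau> \<in> \<T>" "\<tau> \<notin> {{1}, {2}}" for \<tau>
          using that by (simp add: \<alpha>_def \<beta>_def left_part_def right_part_def phi_mod_div)
        have vals: "\<alpha> {1} = \<zeta> {1}" "\<alpha> {2} = a" "\<alpha> {1, 2} = g"
            "\<beta> {1} = b" "\<beta> {2} = \<zeta> {2}" "\<beta> {1, 2} = d"
          unfolding \<alpha>_def \<beta>_def left_part_def right_part_def g_def d_def
          using T12 T ne by auto
        have "PN = (\<Prod>\<tau>\<in>?N. G \<tau> (\<alpha> (c1 \<tau>)) (\<alpha> (c2 \<tau>)) (\<alpha> \<tau>) * H \<tau> (\<beta> (c1 \<tau>)) (\<beta> (c2 \<tau>)) (\<beta> \<tau>))"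
          unfolding PN_def
        proof (intro prod.cong refl)
          fix \<tau> assume \<tau>: "\<tau> \<in> ?N"
          then have in_T: "\<tau> \<in> \<T>" "c1 \<tau> \<in> \<T>" "c2 \<tau> \<in> \<T>" and "\<tau> \<notin> {{1}, {2}}"
            using tree by (auto simp: dimension_tree_def internal_nodes_def)
          moreover have "c1 \<tau> \<notin> {{1}, {2}}" "c2 \<tau> \<notin> {{1}, {2}}"
            using parent_of_first_two_leaves[OF tree k T] \<tau> by auto
          ultimately show "P \<tau> (\<zeta> (c1 \<tau>)) (\<zeta> (c2 \<tau>)) (\<zeta> \<tau>) =
              G \<tau> (\<alpha> (c1 \<tau>)) (\<alpha> (c2 \<tau>)) (\<alpha> \<tau>) * H \<tau> (\<beta> (c1 \<tau>)) (\<beta> (c2 \<tau>)) (\<beta> \<tau>)"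
            using P[of \<tau>] \<tau> bd by (simp add: merged)
        qed
        then have PN: "PN = ?GN \<alpha> * ?HN \<beta>" by (simp add: prod.distrib)
        have "WL = (\<Prod>t\<in>{3..k}. U t $$ (i t, \<alpha> {t}) * V t $$ (i t, \<beta> {t}))"
          unfolding WL_def
        proof (intro prod.cong refl)
          fix t assume t: "t \<in> {3..k}"
          then have "i t < n t" using i by (auto simp: tensor_indices_def PiE_iff)
          moreover have "{t} \<in> \<T>" "{t} \<notin> {{1}, {2}}" using t leaf by auto
          ultimately show "W t $$ (i t, \<zeta> {t}) = U t $$ (i t, \<alpha> {t}) * V t $$ (i t, \<beta> {t})"
            using W[OF t] bd merged[of "{t}"] by simp
        qed
        then have WL: "WL = ?UL \<alpha> * ?VL \<beta>" by (simp add: prod.distrib)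
        show ?thesis
          unfolding \<alpha>_def[symmetric] \<beta>_def[symmetric] x_def y_def vals PN WL
          by (simp only: mult_ac)
      qed
      have bd1: "\<zeta> {1} < r {1}" and bd2: "\<zeta> {2} < s {2}" and bd12: "\<zeta> {1, 2} < r {1, 2} * s {1, 2}"
        using PiE_mem[OF \<zeta> T12(1)] PiE_mem[OF \<zeta> T12(2)] PiE_mem[OF \<zeta> T] ne
        by (auto simp: prod_rank_def)
      have gd: "g < r {1, 2}" "d < s {1, 2}"
        using bd12 r T unfolding g_def d_def
        by (auto simp: less_mult_imp_div_less mult.commute dest!: bspec)
      have "\<zeta> {1, 2} = phi (r {1, 2}) g d"
        by (simp only: g_def d_def phi_mod_div)
      then have P_12: "P {1, 2} (\<zeta> {1}) (\<zeta> {2}) (\<zeta> {1, 2}) =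
          (\<Sum>a<r {2}. \<Sum>b<s {1}. G {1, 2} (\<zeta> {1}) a g * M $$ (a, b) * H {1, 2} b (\<zeta> {2}) d)"
        using P12[OF bd1 bd2 gd] by simp
      have "(\<Sum>a<r {2}. \<Sum>b<s {1}. x (left_part r \<T> \<zeta> a) * y (right_part r \<T> \<zeta> b) *
            M $$ (left_part r \<T> \<zeta> a {2}, right_part r \<T> \<zeta> b {1})) =
          (\<Sum>a<r {2}. \<Sum>b<s {1}. (G {1, 2} (\<zeta> {1}) a g * M $$ (a, b) * H {1, 2} b (\<zeta> {2}) d) *
          (PN * (U 1 $$ (i 1, \<zeta> {1}) * V 2 $$ (i 2, \<zeta> {2}) * WL)))"
        using term_eq by (intro sum.cong refl) auto
      also have "\<dots> = P {1, 2} (\<zeta> {1}) (\<zeta> {2}) (\<zeta> {1, 2}) *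
          (PN * (U 1 $$ (i 1, \<zeta> {1}) * V 2 $$ (i 2, \<zeta> {2}) * WL))"
        by (simp only: P_12 sum_distrib_right)
      also have "\<dots> = (\<Prod>\<tau>\<in>internal_nodes \<T>. P \<tau> (\<zeta> (c1 \<tau>)) (\<zeta> (c2 \<tau>)) (\<zeta> \<tau>)) *
         (\<Prod>t\<in>{1..k}. W t $$ (i t, \<zeta> {t}))"
        unfolding split prod_leaves[OF k] ch12 W1 W2 PN_def WL_def by (simp only: mult_ac)
      finally show "(\<Sum>a<r {2}. \<Sum>b<s {1}. x (left_part r \<T> \<zeta> a) * y (right_part r \<T> \<zeta> b) *
            M $$ (left_part r \<T> \<zeta> a {2}, right_part r \<T> \<zeta> b {1})) =
          (\<Prod>\<tau>\<in>internal_nodes \<T>. P \<tau> (\<zeta> (c1 \<tau>)) (\<zeta> (c2 \<tau>)) (\<zeta> \<tau>)) *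
         (\<Prod>t\<in>{1..k}. W t $$ (i t, \<zeta> {t}))" .
    qed
    finally show ?thesis .
  qed
  moreover have "W t \<in> carrier_mat (n t) (prod_rank r s {t})" if t: "t \<in> {1..k}" for t
  proof -
    consider "t = 1" | "t = 2" | "t \<in> {3..k}" using t by fastforce
    then show ?thesis
      using U[of 1] V[of 2] W_carrier[of t] k by cases (auto simp: prod_rank_def W1[unfolded One_nat_def] W2)
  qed
  moreover have "prod_rank r s {1..k} = 1"
  proof -
    have "{1..k} \<noteq> {1}" "{1..k} \<noteq> {2}" using k by (auto dest: arg_cong[of _ _ card])
    then show ?thesis using X Y by (simp add: prod_rank_def is_htd_def)
  qed
  moreover have "1 \<le> prod_rank r s \<tau>" if "\<tau> \<in> \<T>" for \<tau>
    using r s that by (auto simp: prod_rank_def Suc_le_eq)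
  ultimately show ?thesis
    unfolding is_htd_def by (intro conjI ballI)
qed


section \<open>The higher-order product\<close>

lemma is_htd_cong_leaves:
  assumes "is_htd k m \<T> c1 c2 \<rho> X A B" "\<And>t. t \<in> {1..k} \<Longrightarrow> A t = A' t"
  shows "is_htd k m \<T> c1 c2 \<rho> X A' B"
  using assms by (simp add: is_htd_def)

theorem proposition4p4:
  fixes k l :: nat and n :: "nat \<Rightarrow> nat"
    and \<T> :: "nat set set" and c1 c2 :: "nat set \<Rightarrow> nat set"
    and T S :: "real tensor"
    and r s q :: "nat set \<Rightarrow> nat"
    and U V U' V' W W' :: "nat \<Rightarrow> complex mat"
    and M :: "complex mat"
    and G H P :: "nat set \<Rightarrow> nat \<Rightarrow> nat \<Rightarrow> nat \<Rightarrow> complex"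
  assumes "3 \<le> k"
    and "dimension_tree k \<T> c1 c2" and "{1, 2} \<in> \<T>"
    and "is_htd k (n(2 := l)) \<T> c1 c2 r (\<lambda>i. complex_of_real (T i)) U G"
    and "is_htd k (n(1 := l)) \<T> c1 c2 s (\<lambda>i. complex_of_real (S i)) V H"
    and "W 1 = U 1" and "W 2 = V 2"
    and "\<And>t. t \<in> {3..k} \<Longrightarrow> U' t = dft (n t) * U t"
    and "\<And>t. t \<in> {3..k} \<Longrightarrow> V' t = dft (n t) * V t"
    and "\<And>t. t \<in> {3..k} \<Longrightarrow> W' t \<in> carrier_mat (n t) (r {t} * s {t})"
    and "\<And>t j \<alpha> \<beta>. t \<in> {3..k} \<Longrightarrow> j < n t \<Longrightarrow> \<alpha> < r {t} \<Longrightarrow> \<beta> < s {t} \<Longrightarrow>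
           W' t $$ (j, phi (r {t}) \<alpha> \<beta>) = U' t $$ (j, \<alpha>) * V' t $$ (j, \<beta>)"
    and "\<And>t. t \<in> {3..k} \<Longrightarrow> W t = the (mat_inverse (dft (n t))) * W' t"
    and "M = transpose_mat (U 2) * V 1"
    and "\<And>\<alpha>\<^sub>1 \<beta>\<^sub>2 \<gamma> \<delta>. \<alpha>\<^sub>1 < r {1} \<Longrightarrow> \<beta>\<^sub>2 < s {2} \<Longrightarrow> \<gamma> < r {1, 2} \<Longrightarrow> \<delta> < s {1, 2} \<Longrightarrow>
           P {1, 2} \<alpha>\<^sub>1 \<beta>\<^sub>2 (phi (r {1, 2}) \<gamma> \<delta>) =
             (\<Sum>\<alpha>\<^sub>2<r {2}. \<Sum>\<beta>\<^sub>1<s {1}. G {1, 2} \<alpha>\<^sub>1 \<alpha>\<^sub>2 \<gamma> * M $$ (\<alpha>\<^sub>2, \<beta>\<^sub>1) * H {1, 2} \<beta>\<^sub>1 \<beta>\<^sub>2 \<delta>)"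
    and "\<And>\<tau> \<alpha>\<^sub>1 \<beta>\<^sub>1 \<alpha>\<^sub>2 \<beta>\<^sub>2 \<alpha> \<beta>. \<tau> \<in> internal_nodes \<T> \<Longrightarrow> \<tau> \<noteq> {1, 2} \<Longrightarrow>
           \<alpha>\<^sub>1 < r (c1 \<tau>) \<Longrightarrow> \<beta>\<^sub>1 < s (c1 \<tau>) \<Longrightarrow> \<alpha>\<^sub>2 < r (c2 \<tau>) \<Longrightarrow> \<beta>\<^sub>2 < s (c2 \<tau>) \<Longrightarrow>
           \<alpha> < r \<tau> \<Longrightarrow> \<beta> < s \<tau> \<Longrightarrow>
           P \<tau> (phi (r (c1 \<tau>)) \<alpha>\<^sub>1 \<beta>\<^sub>1) (phi (r (c2 \<tau>)) \<alpha>\<^sub>2 \<beta>\<^sub>2) (phi (r \<tau>) \<alpha> \<beta>) =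
             G \<tau> \<alpha>\<^sub>1 \<alpha>\<^sub>2 \<alpha> * H \<tau> \<beta>\<^sub>1 \<beta>\<^sub>2 \<beta>"
    and "q = (\<lambda>\<tau>. if \<tau> = {1} then r {1} else if \<tau> = {2} then s {2} else r \<tau> * s \<tau>)"
  shows "is_htd k n \<T> c1 c2 q
           (star_H k n l (\<lambda>i. complex_of_real (T i)) (\<lambda>i. complex_of_real (S i))) W P \<and>
         (\<forall>\<tau>\<in>\<T>. q \<tau> \<le> r \<tau> * s \<tau>)"
proof -
  let ?X = "\<lambda>i. complex_of_real (T i)" and ?Y = "\<lambda>i. complex_of_real (S i)"
  have leaves: "\<forall>t\<in>{1..k}. {t} \<in> \<T>"
    using assms(2) by (simp add: dimension_tree_def)
  have q: "q = prod_rank r s"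
    by (simp add: assms(16) prod_rank_def)
  \<comment> \<open>The leaf factors of the facewise product, before the inverse transforms; \<open>W'\<close> describes
    them for \<open>t \<ge> 3\<close> only.\<close>
  define W'' where "W'' t = (if t = 1 then U 1 else if t = 2 then V 2 else W' t)" for t
  have "is_htd k (n(2 := l)) \<T> c1 c2 r (mode_prods k (\<lambda>t. dft (n t)) ?X)
      (\<lambda>t. if t \<in> {3..k} then dft (n t) * U t else U t) G" (is "is_htd _ _ _ _ _ _ ?X' ?U G")
    using assms(4) leaves by (rule is_htd_mode_prods) (simp add: dft_carrier)
  moreover have "is_htd k (n(1 := l)) \<T> c1 c2 s (mode_prods k (\<lambda>t. dft (n t)) ?Y)
      (\<lambda>t. if t \<in> {3..k} then dft (n t) * V t else V t) H" (is "is_htd _ _ _ _ _ _ ?Y' ?V H")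
    using assms(5) leaves by (rule is_htd_mode_prods) (simp add: dft_carrier)
  ultimately have "is_htd k n \<T> c1 c2 q (facewise_prod l ?X' ?Y') W'' P"
    unfolding q
    by (rule is_htd_facewise_prod[OF assms(1-3), where M = M])
      (use assms(8-15) in \<open>auto simp: W''_def\<close>)
  then have "is_htd k n \<T> c1 c2 q (star_H k n l ?X ?Y)
      (\<lambda>t. if t \<in> {3..k} then the (mat_inverse (dft (n t))) * W'' t else W'' t) P"
    unfolding star_H_def
    using leaves by (rule is_htd_mode_prods) (simp add: mat_inverse_dft_carrier)
  then have "is_htd k n \<T> c1 c2 q (star_H k n l ?X ?Y) W P"
  proof (rule is_htd_cong_leaves)
    fix t assume "t \<in> {1..k}"
    then consider "t = 1" | "t = 2" | "t \<in> {3..k}" by fastforce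
    then show "(if t \<in> {3..k} then the (mat_inverse (dft (n t))) * W'' t else W'' t) = W t"
      using assms(6,7,12) by cases (auto simp: W''_def)
  qed
  moreover have "q \<tau> \<le> r \<tau> * s \<tau>" if "\<tau> \<in> \<T>" for \<tau>
    using that assms(4,5) by (auto simp: q prod_rank_def is_htd_def)
  ultimately show ?thesis by blast
qed

end
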